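(* Let $\mathcal{C}$ be a graph class of bounded local-treewidth. Then deciding whether a given graph $G\in\mathcal{C}$ is well covered is FPT parameterized by $\alpha(G)$; more precisely, there is a function $f$ and an algorithm that solves it in $O(f(\alpha(G))\cdot n^2)$ time, where $n=|V(G)|$.
   Context: $\alpha(G)$ is the size of a maximum independent set of $G$. $G$ is well covered if all maximal independent sets of $G$ have the same size. The local-treewidth of $G$ is the function $ltw_G:\mathbb{N}\to\mathbb{N}$ with $ltw_G(r)=\max_{v\in V(G)} tw(G[N_r(v)])$, where $N_r(v)$ is the set of vertices at distance at most $r$ from $v$ and $tw$ denotes treewidth. A class $\mathcal{C}$ has bounded local-treewidth if there is a function $f_{\mathcal{C}}:\mathbb{N}\to\mathbb{N}$ with $ltw_G(r)\leq f_{\mathcal{C}}(r)$ for all $G\in\mathcal{C}$ and $r\in\mathbb{N}$. *)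

theory Defs
  imports Main "HOL-Library.Extended_Nat"
begin

type_synonym 'a ugraph = "'a set \<times> 'a set set"

abbreviation verts :: "'a ugraph \<Rightarrow> 'a set" where
  "verts G \<equiv> fst G"

abbreviation edges :: "'a ugraph \<Rightarrow> 'a set set" where
  "edges G \<equiv> snd G"

definition simple_graph :: "'a ugraph \<Rightarrow> bool" where
  "simple_graph G \<longleftrightarrow> finite (verts G) \<and> (\<forall>e\<in>edges G. e \<subseteq> verts G \<and> card e = 2)"

definition induced :: "'a ugraph \<Rightarrow> 'a set \<Rightarrow> 'a ugraph" where
  "induced G S = (verts G \<inter> S, {e \<in> edges G. e \<subseteq> S})"

definition walk :: "'a ugraph \<Rightarrow> 'a list \<Rightarrow> bool" where
  "walk G p \<longleftrightarrow> p \<noteq> [] \<and> set p \<subseteq> verts G \<and> successively (\<lambda>u v. {u, v} \<in> edges G) p"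

definition gdist :: "'a ugraph \<Rightarrow> 'a \<Rightarrow> 'a \<Rightarrow> enat" where
  "gdist G u v = (INF p \<in> {p. walk G p \<and> hd p = u \<and> last p = v}. enat (length p - 1))"

definition neighbourhood :: "'a ugraph \<Rightarrow> nat \<Rightarrow> 'a \<Rightarrow> 'a set" where
  "neighbourhood G r v = {u \<in> verts G. gdist G v u \<le> enat r}"

definition connected_graph :: "'a ugraph \<Rightarrow> bool" where
  "connected_graph G \<longleftrightarrow> verts G \<noteq> {} \<and>
     (\<forall>u\<in>verts G. \<forall>v\<in>verts G. \<exists>p. walk G p \<and> hd p = u \<and> last p = v)"

definition cycle :: "'a ugraph \<Rightarrow> 'a list \<Rightarrow> bool" where
  "cycle G p \<longleftrightarrow> walk G p \<and> distinct p \<and> 3 \<le> length p \<and> {last p, hd p} \<in> edges G"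

definition tree :: "'a ugraph \<Rightarrow> bool" where
  "tree G \<longleftrightarrow> simple_graph G \<and> connected_graph G \<and> (\<nexists>p. cycle G p)"

definition tree_decomposition :: "'a ugraph \<Rightarrow> nat ugraph \<Rightarrow> (nat \<Rightarrow> 'a set) \<Rightarrow> bool" where
  "tree_decomposition G T B \<longleftrightarrow>
     tree T \<and>
     (\<Union>t\<in>verts T. B t) = verts G \<and>
     (\<forall>e\<in>edges G. \<exists>t\<in>verts T. e \<subseteq> B t) \<and>
     (\<forall>v\<in>verts G. connected_graph (induced T {t. v \<in> B t}))"

definition width :: "nat ugraph \<Rightarrow> (nat \<Rightarrow> 'a set) \<Rightarrow> nat" where
  "width T B = Max ((\<lambda>t. card (B t)) ` verts T) - 1"

definition treewidth :: "'a ugraph \<Rightarrow> nat" where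
  "treewidth G = (LEAST k. \<exists>T B. tree_decomposition G T B \<and> width T B = k)"

text \<open>
  On finite nonempty sets of naturals the supremum is the maximum; the graph without
  vertices gets the value 0.
\<close>

definition local_treewidth :: "'a ugraph \<Rightarrow> nat \<Rightarrow> nat" where
  "local_treewidth G r = (SUP v\<in>verts G. treewidth (induced G (neighbourhood G r v)))"

definition bounded_local_treewidth :: "'a ugraph set \<Rightarrow> bool" where
  "bounded_local_treewidth \<C> \<longleftrightarrow>
     (\<exists>f :: nat \<Rightarrow> nat. \<forall>G\<in>\<C>. \<forall>r. local_treewidth G r \<le> f r)"

definition independent :: "'a ugraph \<Rightarrow> 'a set \<Rightarrow> bool" where
  "independent G S \<longleftrightarrow> S \<subseteq> verts G \<and> (\<forall>u\<in>S. \<forall>v\<in>S. {u, v} \<notin> edges G)"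

definition maximal_independent :: "'a ugraph \<Rightarrow> 'a set \<Rightarrow> bool" where
  "maximal_independent G S \<longleftrightarrow> independent G S \<and> (\<forall>T. independent G T \<and> S \<subseteq> T \<longrightarrow> T = S)"

definition alpha :: "'a ugraph \<Rightarrow> nat" where
  "alpha G = Max (card ` {S. independent G S})"

definition well_covered :: "'a ugraph \<Rightarrow> bool" where
  "well_covered G \<longleftrightarrow>
     (\<forall>S T. maximal_independent G S \<and> maximal_independent G T \<longrightarrow> card S = card T)"

text \<open>
  The standard RAM under the uniform cost measure: registers hold natural numbers, the
  arithmetic operations are addition, truncated subtraction and halving (in particular no
  multiplication), and the input is a read-only array.  A program halts when the program
  counter leaves it; the output is the content of register 0.
\<close>

datatype instr =
    Const nat nat
  | Read nat nat
  | Load nat nat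
  | Store nat nat
  | Add nat nat nat
  | Sub nat nat nat
  | Half nat nat
  | Jump nat
  | JumpZero nat nat

type_synonym config = "nat \<times> (nat \<Rightarrow> nat)"

fun exec :: "nat list \<Rightarrow> instr \<Rightarrow> config \<Rightarrow> config" where
  "exec x (Const i c) (pc, r) = (Suc pc, r(i := c))"
| "exec x (Read i j) (pc, r) = (Suc pc, r(i := (if r j < length x then x ! r j else 0)))"
| "exec x (Load i j) (pc, r) = (Suc pc, r(i := r (r j)))"
| "exec x (Store i j) (pc, r) = (Suc pc, r(r i := r j))"
| "exec x (Add i j k) (pc, r) = (Suc pc, r(i := r j + r k))"
| "exec x (Sub i j k) (pc, r) = (Suc pc, r(i := r j - r k))"
| "exec x (Half i j) (pc, r) = (Suc pc, r(i := r j div 2))"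
| "exec x (Jump l) (pc, r) = (l, r)"
| "exec x (JumpZero i l) (pc, r) = (if r i = 0 then l else Suc pc, r)"

definition step :: "instr list \<Rightarrow> nat list \<Rightarrow> config \<Rightarrow> config" where
  "step P x s = (if fst s < length P then exec x (P ! fst s) s else s)"

text \<open>Halted configurations are fixed points of \<open>step\<close>, so this means ``within \<open>t\<close> steps''.\<close>

definition outputs_within :: "instr list \<Rightarrow> nat list \<Rightarrow> nat \<Rightarrow> nat \<Rightarrow> bool" where
  "outputs_within P x t b \<longleftrightarrow>
     (let s = (step P x ^^ t) (0, \<lambda>_. 0) in length P \<le> fst s \<and> snd s 0 = b)"

text \<open>
  The number of vertices followed by the rows of the adjacency matrix, with respect to an
  enumeration of the vertices.
\<close>

definition encode :: "'a ugraph \<Rightarrow> 'a list \<Rightarrow> nat list" where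
  "encode G vs = length vs # [if {u, v} \<in> edges G then 1 else 0. u \<leftarrow> vs, v \<leftarrow> vs]"

text \<open>
  One program decides the property on every graph of the class, however its vertices are
  enumerated, in time \<open>O(T G)\<close>.  The graph without vertices is exempt from the time bound only:
  bounds of the form \<open>f(k) \<sqdot> n\<^sup>d\<close> vanish there.
\<close>

definition decidable_in_time ::
    "'a ugraph set \<Rightarrow> ('a ugraph \<Rightarrow> bool) \<Rightarrow> ('a ugraph \<Rightarrow> nat) \<Rightarrow> bool" where
  "decidable_in_time \<C> Q T \<longleftrightarrow>
     (\<exists>P c. \<forall>G\<in>\<C>. \<forall>vs. distinct vs \<and> set vs = verts G \<longrightarrow>
        (\<exists>t. outputs_within P (encode G vs) t (if Q G then 1 else 0) \<and>
             (verts G \<noteq> {} \<longrightarrow> t \<le> c * T G)))"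

definition FPT_parameterized_by ::
    "'a ugraph set \<Rightarrow> ('a ugraph \<Rightarrow> bool) \<Rightarrow> ('a ugraph \<Rightarrow> nat) \<Rightarrow> bool" where
  "FPT_parameterized_by \<C> Q \<kappa> \<longleftrightarrow>
     (\<exists>(f :: nat \<Rightarrow> nat) d. decidable_in_time \<C> Q (\<lambda>G. f (\<kappa> G) * card (verts G) ^ d))"

end

theory Submission
  imports Defs "HOL-Library.Ramsey" "HOL-Library.Nat_Bijection"
begin

text \<open>
  A clique \<open>K\<close> lies in the neighbourhood of radius 1 of each of its vertices, and in any tree
  decomposition some bag contains it, so bounded local treewidth bounds the clique number on the
  class.  By Ramsey's theorem the number \<open>n\<close> of vertices is then bounded by a function of the
  independence number.  Hence any correct program that halts on every input is fast enough: there
  are only finitely many encodings of graphs with \<open>n\<close> vertices, so its running time is bounded by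
  a function of \<open>n\<close>.  The program enumerates all vertex sets as bit masks, and a graph is well
  covered iff the maximum of \<open>s\<close> and the maximum of \<open>n - s\<close> over the sizes \<open>s\<close> of the maximal
  independent sets add up to at most \<open>n\<close>.
\<close>

section \<open>Bounding the order by the independence number\<close>

text \<open>Stated by cuts rather than walks, so that deleting a leaf needs no rerouting. Only edges
  inside \<open>A\<close> count; \<open>E\<close> may be larger, which lets all subtrees share the
  edge set of the tree.\<close>

definition cut_connected :: "'a set set \<Rightarrow> 'a set \<Rightarrow> bool" where
  "cut_connected E A \<longleftrightarrow>
     (\<forall>X. X \<subseteq> A \<and> X \<noteq> {} \<and> X \<noteq> A \<longrightarrow> (\<exists>x\<in>X. \<exists>y\<in>A - X. {x, y} \<in> E))"

lemma walk_crosses_cut: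
  assumes "walk G p" "hd p \<in> X" "last p \<notin> X"
  shows "\<exists>x\<in>X. \<exists>y\<in>verts G - X. {x, y} \<in> edges G"
  using assms
proof (induction p)
  case Nil
  then show ?case by (simp add: walk_def)
next
  case (Cons a p)
  show ?case
  proof (cases p)
    case Nil
    with Cons.prems show ?thesis by simp
  next
    case (Cons b q)
    then have w: "walk G p" "{a, b} \<in> edges G" "b \<in> verts G"
      using Cons.prems(1) by (auto simp: walk_def)
    show ?thesis
    proof (cases "b \<in> X")
      case True
      then show ?thesis using Cons.IH Cons.prems w Cons by auto
    next
      case False
      then show ?thesis using Cons.prems w by auto
    qed
  qed
qed

lemma connected_graph_imp_cut_connected:
  assumes "connected_graph G"
  shows "cut_connected (edges G) (verts G)"
  unfolding cut_connected_def
proof (intro allI impI)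
  fix X assume X: "X \<subseteq> verts G \<and> X \<noteq> {} \<and> X \<noteq> verts G"
  then obtain u v where uv: "u \<in> X" "v \<in> verts G - X" by blast
  then obtain p where "walk G p" "hd p = u" "last p = v"
    using assms X unfolding connected_graph_def by blast
  then show "\<exists>x\<in>X. \<exists>y\<in>verts G - X. {x, y} \<in> edges G"
    using walk_crosses_cut uv by (metis DiffD2)
qed

text \<open>A cut of \<open>A - {l}\<close> becomes a cut of \<open>A\<close> when \<open>l\<close>
  joins the side of \<open>p\<close>; the crossing edge found there avoids \<open>l\<close>, whose
  only possible neighbour is on its own side.\<close>

lemma cut_connected_remove_leaf:
  assumes A: "cut_connected E A" "l \<in> A"
    and leaf: "\<And>y. y \<in> A \<Longrightarrow> {l, y} \<in> E \<Longrightarrow> y = p"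
  shows "cut_connected E (A - {l})"
  unfolding cut_connected_def
proof (intro allI impI)
  fix X assume X: "X \<subseteq> A - {l} \<and> X \<noteq> {} \<and> X \<noteq> A - {l}"
  show "\<exists>x\<in>X. \<exists>y\<in>A - {l} - X. {x, y} \<in> E"
  proof (cases "p \<in> X")
    case False
    have "X \<subseteq> A" "X \<noteq> {}" "X \<noteq> A" using X assms(2) by auto
    then obtain x y where xy: "x \<in> X" "y \<in> A - X" "{x, y} \<in> E"
      using A(1) unfolding cut_connected_def by meson
    have "y \<noteq> l"
      using leaf[of x] xy X False by (auto simp: insert_commute)
    then show ?thesis using xy by blast
  next
    case True
    let ?Y = "A - {l} - X"
    have "?Y \<subseteq> A" "?Y \<noteq> {}" "?Y \<noteq> A" using X assms(2) by auto
    then obtain x y where xy: "x \<in> ?Y" "y \<in> A - ?Y" "{x, y} \<in> E"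
      using A(1) unfolding cut_connected_def by meson
    have "y \<noteq> l"
      using leaf[of x] xy X True by (auto simp: insert_commute)
    then have "y \<in> X" "x \<in> A - {l} - X" "{y, x} \<in> E"
      using xy by (auto simp: insert_commute)
    then show ?thesis by blast
  qed
qed

lemma cut_connected_leaf_neighbour:
  assumes "cut_connected E A" "l \<in> A" "A \<noteq> {l}"
    and "\<And>y. y \<in> A \<Longrightarrow> {l, y} \<in> E \<Longrightarrow> y = p"
  shows "p \<in> A - {l}"
proof -
  have "{l} \<subseteq> A" "{l} \<noteq> {}" "{l} \<noteq> A" using assms by auto
  then obtain y where "y \<in> A - {l}" "{l, y} \<in> E"
    using assms(1) unfolding cut_connected_def by (metis singletonD)
  then show ?thesis using assms(4) by blast
qed

text \<open>Take a longest path inside \<open>S\<close>: a neighbour in \<open>S\<close> of its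
  first vertex lies on it by maximality, and at position 1, since a later position would close a
  cycle. Isolated vertices count as leaves.\<close>

lemma acyclic_has_leaf:
  assumes fin: "finite S" and S: "S \<noteq> {}" "S \<subseteq> verts G"
    and loopfree: "\<And>x. {x} \<notin> edges G" and acyclic: "\<nexists>p. cycle G p"
  shows "\<exists>l\<in>S. \<exists>p. \<forall>y\<in>S. {l, y} \<in> edges G \<longrightarrow> y = p"
proof -
  define path where "path p \<longleftrightarrow> walk G p \<and> distinct p \<and> set p \<subseteq> S" for p
  obtain s where "s \<in> S" using S by blast
  then have "path [s]" using S by (auto simp: path_def walk_def)
  moreover have "\<forall>p. path p \<longrightarrow> length p < Suc (card S)"
    using fin by (metis card_mono distinct_card le_imp_less_Suc path_def)
  ultimately obtain p where p: "path p" and longest: "\<And>q. path q \<Longrightarrow> length q \<le> length p"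
    using ex_has_greatest_nat[of path "[s]" length "Suc (card S)"] by blast
  have ne: "p \<noteq> []" using p by (simp add: path_def walk_def)
  let ?l = "hd p"
  \<comment> \<open>On a one-vertex path \<open>p ! 1\<close> is out of range, but then
    \<open>?l\<close> has no neighbour in \<open>S\<close> and nothing is claimed.\<close>
  have nb: "y = p ! 1" if y: "y \<in> S" "{?l, y} \<in> edges G" for y
  proof -
    have "y \<in> set p"
    proof (rule ccontr)
      assume "y \<notin> set p"
      then have "path (y # p)"
        using p y S ne by (cases p) (auto simp: path_def walk_def insert_commute)
      then show False using longest by force
    qed
    then obtain j where j: "j < length p" "p ! j = y" by (auto simp: in_set_conv_nth)
    have "j \<noteq> 0"
      using j y loopfree ne by (metis hd_conv_nth insert_absorb2)
    moreover have "\<not> 2 \<le> j"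
    proof
      assume j2: "2 \<le> j"
      let ?c = "take (Suc j) p"
      have "walk G ?c"
        using p ne unfolding path_def walk_def
        by (auto dest: in_set_takeD)
          (metis append_take_drop_id successively_append_iff)
      moreover have "last ?c = y" "hd ?c = ?l"
        using j by (auto simp: take_Suc_conv_app_nth hd_append hd_conv_nth)
      ultimately have "cycle G ?c"
        using p j j2 y by (auto simp: path_def cycle_def insert_commute)
      then show False using acyclic by blast
    qed
    ultimately have "j = 1" by linarith
    then show ?thesis using j by simp
  qed
  have "?l \<in> S" using p ne by (auto simp: path_def)
  then show ?thesis using nb by blast
qed

text \<open>
  The Helly property of subtrees, by removing leaves: a leaf that is the only node of a member
  belongs to every member, and otherwise a member containing the leaf contains its neighbour.
\<close>

lemma helly_subtrees:
  assumes "finite S"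
    and "\<And>R. R \<subseteq> S \<Longrightarrow> R \<noteq> {} \<Longrightarrow> \<exists>l\<in>R. \<exists>p. \<forall>y\<in>R. {l, y} \<in> E \<longrightarrow> y = p"
    and "\<And>v. v \<in> K \<Longrightarrow> A v \<subseteq> S \<and> cut_connected E (A v)"
    and "\<And>u v. u \<in> K \<Longrightarrow> v \<in> K \<Longrightarrow> A u \<inter> A v \<noteq> {}"
    and "K \<noteq> {}"
  shows "\<exists>t\<in>S. \<forall>v\<in>K. t \<in> A v"
  using assms
proof (induction "card S" arbitrary: S A)
  case 0
  \<comment> \<open>With \<open>S\<close> empty every member is empty, yet a member must meet
    itself.\<close>
  then show ?case by (metis card_0_eq ex_in_conv inf.idem subset_empty)
next
  case (Suc n)
  have "S \<noteq> {}" using Suc.hyps(2) by auto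
  then obtain l p where l: "l \<in> S" and lp: "\<And>y. y \<in> S \<Longrightarrow> {l, y} \<in> E \<Longrightarrow> y = p"
    using Suc.prems(2)[of S] by auto
  have sub: "A v \<subseteq> S" and conn: "cut_connected E (A v)" if "v \<in> K" for v
    using Suc.prems(3) that by auto
  show ?case
  proof (cases "\<exists>v\<in>K. A v = {l}")
    case True
    then obtain v where v: "v \<in> K" "A v = {l}" by blast
    then have "l \<in> A u" if "u \<in> K" for u using Suc.prems(4)[of u v] that by auto
    then show ?thesis using l by blast
  next
    case False
    have p: "p \<in> A v - {l}" if "v \<in> K" "l \<in> A v" for v
    proof (rule cut_connected_leaf_neighbour[OF conn])
      show "y = p" if "y \<in> A v" "{l, y} \<in> E" for y
        using that sub[OF \<open>v \<in> K\<close>] lp by blast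
    qed (use that False in auto)
    have "\<exists>t\<in>S - {l}. \<forall>v\<in>K. t \<in> A v - {l}"
    proof (rule Suc.hyps(1))
      show "n = card (S - {l})" using Suc.hyps(2) l Suc.prems(1) by simp
      show "finite (S - {l})" using Suc.prems(1) by simp
      show "\<exists>l\<in>R. \<exists>p. \<forall>y\<in>R. {l, y} \<in> E \<longrightarrow> y = p"
        if "R \<subseteq> S - {l}" "R \<noteq> {}" for R using Suc.prems(2) that by blast
      show "A v - {l} \<subseteq> S - {l} \<and> cut_connected E (A v - {l})" if v: "v \<in> K" for v
      proof
        show "A v - {l} \<subseteq> S - {l}" using sub v by blast
        show "cut_connected E (A v - {l})"
        proof (cases "l \<in> A v")
          case True
          then show ?thesis
          proof (rule cut_connected_remove_leaf[OF conn[OF v]])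
            show "y = p" if "y \<in> A v" "{l, y} \<in> E" for y
              using that sub[OF v] lp by blast
          qed
        next
          case False
          then show ?thesis using conn v by simp
        qed
      qed
      \<comment> \<open>Two members that meet in \<open>l\<close> also meet in \<open>p\<close>, so
        no intersection is lost with the leaf.\<close>
      show "(A u - {l}) \<inter> (A v - {l}) \<noteq> {}" if "u \<in> K" "v \<in> K" for u v
        using Suc.prems(4)[of u v] that p[of u] p[of v] by blast
    qed (use Suc.prems in auto)
    then show ?thesis by blast
  qed
qed

section \<open>Cliques, bags and treewidth\<close>

text \<open>The nodes whose bags contain a given vertex form a subtree, and the subtrees of adjacent
  vertices meet in a bag containing the edge; the Helly property yields a common node.\<close>

lemma clique_in_bag:
  assumes td: "tree_decomposition G T B" and K: "K \<subseteq> verts G" "K \<noteq> {}"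
    and clique: "\<And>u v. u \<in> K \<Longrightarrow> v \<in> K \<Longrightarrow> u \<noteq> v \<Longrightarrow> {u, v} \<in> edges G"
  shows "\<exists>t\<in>verts T. K \<subseteq> B t"
proof -
  define A where "A v = {t \<in> verts T. v \<in> B t}" for v
  have T: "finite (verts T)" "\<nexists>p. cycle T p" and loop: "\<And>x. {x} \<notin> edges T"
    using td by (force simp: tree_decomposition_def tree_def simple_graph_def)+
  have "\<exists>t\<in>verts T. \<forall>v\<in>K. t \<in> A v"
  proof (rule helly_subtrees[where E = "edges T"])
    show "\<exists>l\<in>R. \<exists>p. \<forall>y\<in>R. {l, y} \<in> edges T \<longrightarrow> y = p"
      if "R \<subseteq> verts T" "R \<noteq> {}" for R
      using acyclic_has_leaf[of R T] that T loop finite_subset by metis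
    show "A v \<subseteq> verts T \<and> cut_connected (edges T) (A v)" if "v \<in> K" for v
    proof -
      have "connected_graph (induced T {t. v \<in> B t})"
        using td K that by (auto simp: tree_decomposition_def)
      then have "cut_connected (edges (induced T {t. v \<in> B t})) (verts (induced T {t. v \<in> B t}))"
        by (rule connected_graph_imp_cut_connected)
      moreover have "verts (induced T {t. v \<in> B t}) = A v"
        "edges (induced T {t. v \<in> B t}) \<subseteq> edges T"
        by (auto simp: induced_def A_def)
      ultimately have "cut_connected (edges T) (A v)"
        unfolding cut_connected_def by (metis subsetD)
      then show ?thesis by (auto simp: A_def)
    qed
    show "A u \<inter> A v \<noteq> {}" if uv: "u \<in> K" "v \<in> K" for u v
    proof (cases "u = v")
      case True
      have "u \<in> (\<Union>t\<in>verts T. B t)" using td K uv by (auto simp: tree_decomposition_def)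
      then show ?thesis using True by (auto simp: A_def)
    next
      case False
      then obtain t where "t \<in> verts T" "{u, v} \<subseteq> B t"
        using td clique uv unfolding tree_decomposition_def by meson
      then show ?thesis by (auto simp: A_def)
    qed
  qed (use T K in auto)
  then show ?thesis by (auto simp: A_def)
qed

text \<open>The one-bag decomposition shows that the minimum in \<open>treewidth\<close> is over a
  nonempty set, hence attained.\<close>

lemma tree_decomposition_trivial:
  assumes "\<And>e. e \<in> edges G \<Longrightarrow> e \<subseteq> verts G"
  shows "tree_decomposition G ({0}, {}) (\<lambda>_. verts G)"
proof -
  have walk: "walk ({0::nat}, {}) [0]" by (simp add: walk_def)
  have conn: "connected_graph ({0::nat}, {})"
    unfolding connected_graph_def by (auto intro!: exI[of _ "[0::nat]"] walk)
  have "tree ({0::nat}, {})"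
    using conn by (auto simp: tree_def simple_graph_def cycle_def)
  then show ?thesis
    using assms conn by (auto simp: tree_decomposition_def induced_def)
qed

lemma clique_card_le_treewidth:
  assumes G: "simple_graph G" and K: "K \<subseteq> verts G"
    and clique: "\<And>u v. u \<in> K \<Longrightarrow> v \<in> K \<Longrightarrow> u \<noteq> v \<Longrightarrow> {u, v} \<in> edges G"
  shows "card K \<le> treewidth G + 1"
proof (cases "K = {}")
  case False
  have "\<exists>k T B. tree_decomposition G T B \<and> width T B = k"
    using tree_decomposition_trivial G unfolding simple_graph_def by blast
  then have "\<exists>T B. tree_decomposition G T B \<and> width T B = treewidth G"
    unfolding treewidth_def by (rule LeastI_ex)
  then obtain T B where td: "tree_decomposition G T B" and w: "width T B = treewidth G"
    by blast
  obtain t where t: "t \<in> verts T" "K \<subseteq> B t"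
    using clique_in_bag[OF td K False clique] by blast
  have fin: "finite (verts T)"
    using td by (simp add: tree_decomposition_def tree_def simple_graph_def)
  have "B t \<subseteq> verts G" using td t by (auto simp: tree_decomposition_def)
  then have "card K \<le> card (B t)"
    using t G by (meson card_mono finite_subset simple_graph_def)
  also have "\<dots> \<le> Max ((\<lambda>t. card (B t)) ` verts T)"
    using fin t by simp
  also have "\<dots> \<le> treewidth G + 1" using w by (simp add: width_def)
  finally show ?thesis .
qed simp

lemma clique_card_le_local_treewidth:
  assumes G: "simple_graph G" and K: "K \<subseteq> verts G"
    and clique: "\<And>u v. u \<in> K \<Longrightarrow> v \<in> K \<Longrightarrow> u \<noteq> v \<Longrightarrow> {u, v} \<in> edges G"
  shows "card K \<le> local_treewidth G 1 + 1"
proof (cases "K = {}")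
  case False
  then obtain v where v: "v \<in> K" by blast
  let ?N = "neighbourhood G 1 v"
  have "K \<subseteq> ?N"
  proof
    fix u assume u: "u \<in> K"
    define p where "p = (if u = v then [v] else [v, u])"
    have "p \<in> {p. walk G p \<and> hd p = v \<and> last p = u}"
      using u v K clique by (auto simp: p_def walk_def)
    then have "gdist G v u \<le> enat (length p - 1)"
      unfolding gdist_def by (rule INF_lower)
    also have "\<dots> \<le> enat 1" by (simp add: p_def)
    finally show "u \<in> ?N" using u K by (auto simp: neighbourhood_def)
  qed
  then have "card K \<le> treewidth (induced G ?N) + 1"
    using G K clique
    by (intro clique_card_le_treewidth) (auto simp: simple_graph_def induced_def)
  also have "treewidth (induced G ?N) \<le> local_treewidth G 1"
    unfolding local_treewidth_def
    using G K v by (intro cSUP_upper) (auto simp: simple_graph_def)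
  finally show ?thesis by simp
qed simp

section \<open>From cliques to the order by Ramsey's theorem\<close>

lemma independent_card_le_alpha:
  assumes "simple_graph G" "independent G S"
  shows "card S \<le> alpha G"
proof -
  have "{S. independent G S} \<subseteq> Pow (verts G)" by (auto simp: independent_def)
  then have "finite {S. independent G S}"
    using assms(1) by (meson finite_Pow_iff finite_subset simple_graph_def)
  then show ?thesis using assms(2) by (auto simp: alpha_def)
qed

lemma bounded_local_treewidth_imp_order_bounded:
  assumes simple: "\<forall>G\<in>\<C>. simple_graph G" and "bounded_local_treewidth \<C>"
  shows "\<exists>h :: nat \<Rightarrow> nat. \<forall>G\<in>\<C>. card (verts G) \<le> h (alpha G)"
proof -
  obtain f :: "nat \<Rightarrow> nat" where f: "\<And>G r. G \<in> \<C> \<Longrightarrow> local_treewidth G r \<le> f r"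
    using assms(2) unfolding bounded_local_treewidth_def by blast
  \<comment> \<open>Both sizes are one too large: cliques have at most \<open>f 1 + 1\<close>
    vertices, and \<open>k\<close> will be the independence number.\<close>
  have "\<forall>k. \<exists>r. \<forall>(V :: 'a set) E. finite V \<and> r \<le> card V \<longrightarrow>
      (\<exists>R\<subseteq>V. card R = f 1 + 2 \<and> clique R E \<or> card R = Suc k \<and> indep R E)"
    using ramsey2 by metis
  then obtain h where h: "\<And>k (V :: 'a set) E. finite V \<Longrightarrow> h k \<le> card V \<Longrightarrow>
      \<exists>R\<subseteq>V. card R = f 1 + 2 \<and> clique R E \<or> card R = Suc k \<and> indep R E"
    by metis
  have "card (verts G) \<le> h (alpha G)" if GC: "G \<in> \<C>" for G
  proof (rule ccontr)
    assume "\<not> card (verts G) \<le> h (alpha G)"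
    moreover have G: "simple_graph G" using simple GC by blast
    ultimately obtain R where R: "R \<subseteq> verts G"
      "card R = f 1 + 2 \<and> clique R (edges G) \<or> card R = Suc (alpha G) \<and> indep R (edges G)"
      using h[of "verts G" "alpha G" "edges G"] unfolding simple_graph_def by auto
    from R(2) show False
    proof
      assume c: "card R = f 1 + 2 \<and> clique R (edges G)"
      then have "card R \<le> local_treewidth G 1 + 1"
        using clique_card_le_local_treewidth[OF G R(1)] by (auto simp: clique_def)
      then show False using c f[OF GC, of 1] by simp
    next
      assume i: "card R = Suc (alpha G) \<and> indep R (edges G)"
      \<comment> \<open>\<open>indep\<close> speaks of distinct vertices only, whereas
        \<open>independent\<close> also forbids loops.\<close>
      have "{u} \<notin> edges G" for u using G by (auto simp: simple_graph_def)
      then have "independent G R"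
        using R(1) i by (auto simp: independent_def indep_def) (metis insert_absorb2)
      then show False using independent_card_le_alpha[OF G] i by fastforce
    qed
  qed
  then show ?thesis by blast
qed

section \<open>A loop language on the RAM\<close>

datatype prog = Block "instr list" | Seq prog prog (infixr ";;" 60) | Loop nat prog

text \<open>\<open>Store\<close> is excluded along with the jumps: its destination depends on
  register contents, while \<open>writes\<close> is computed from the program text.\<close>

fun straight :: "instr \<Rightarrow> bool" where
  "straight (Store i j) = False"
| "straight (Jump l) = False"
| "straight (JumpZero i l) = False"
| "straight _ = True"

fun target :: "instr \<Rightarrow> nat" where
  "target (Const i c) = i"
| "target (Read i j) = i"
| "target (Load i j) = i"
| "target (Add i j k) = i"
| "target (Sub i j k) = i"
| "target (Half i j) = i"
| "target _ = 0"

fun writes :: "prog \<Rightarrow> nat set" where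
  "writes (Block as) = target ` set as"
| "writes (p ;; q) = writes p \<union> writes q"
| "writes (Loop i p) = insert 0 (insert i (writes p))"

text \<open>
  Register 0 is the scratch register that holds the decrement of the loop counters; the loop
  bodies do not write their counters, so every program halts.
\<close>

fun sem :: "nat list \<Rightarrow> prog \<Rightarrow> (nat \<Rightarrow> nat) \<Rightarrow> nat \<Rightarrow> nat" where
  "sem x (Block as) r = fold (\<lambda>a r. snd (exec x a (0, r))) as r"
| "sem x (p ;; q) r = sem x q (sem x p r)"
| "sem x (Loop i p) r = ((\<lambda>r. sem x p (r(0 := 1, i := r i - 1))) ^^ r i) r"

fun wf_prog :: "prog \<Rightarrow> bool" where
  "wf_prog (Block as) \<longleftrightarrow> (\<forall>a\<in>set as. straight a)"
| "wf_prog (p ;; q) \<longleftrightarrow> wf_prog p \<and> wf_prog q"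
| "wf_prog (Loop i p) \<longleftrightarrow> wf_prog p \<and> i \<noteq> 0 \<and> i \<notin> writes p"

fun code_length :: "prog \<Rightarrow> nat" where
  "code_length (Block as) = length as"
| "code_length (p ;; q) = code_length p + code_length q"
| "code_length (Loop i p) = code_length p + 4"

text \<open>Jump targets are absolute, hence the start address \<open>b\<close>. The decrement goes
  through register 0 because \<open>Sub\<close> takes only register operands.\<close>

fun compile :: "nat \<Rightarrow> prog \<Rightarrow> instr list" where
  "compile b (Block as) = as"
| "compile b (p ;; q) = compile b p @ compile (b + code_length p) q"
| "compile b (Loop i p) =
     [JumpZero i (b + code_length p + 4), Const 0 1, Sub i i 0] @ compile (b + 3) p @ [Jump b]"

lemma length_compile [simp]: "length (compile b p) = code_length p"
  by (induction p arbitrary: b) auto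

lemma exec_straight:
  assumes "straight a"
  shows "exec x a (pc, r) = (Suc pc, snd (exec x a (0, r)))"
  using assms by (cases a) auto

lemma exec_preserves:
  assumes "straight a" "j \<noteq> target a"
  shows "snd (exec x a (pc, r)) j = r j"
  using assms by (cases a) auto

lemma sem_preserves:
  assumes "wf_prog p" "j \<notin> writes p"
  shows "sem x p r j = r j"
  using assms
proof (induction p arbitrary: r)
  case (Block as)
  then show ?case by (induction as arbitrary: r) (auto simp: exec_preserves)
next
  case (Loop i p)
  have "((\<lambda>r. sem x p (r(0 := 1, i := r i - 1))) ^^ k) r j = r j" for k
    using Loop by (induction k) auto
  then show ?case by simp
qed auto

section \<open>Compiled code simulates the semantics\<close>

text \<open>Step counts are forgotten on purpose: the time bound will come from the finiteness of
  the set of inputs, so termination is enough.\<close>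

definition reaches :: "instr list \<Rightarrow> nat list \<Rightarrow> config \<Rightarrow> config \<Rightarrow> bool" where
  "reaches P x s s' \<longleftrightarrow> (\<exists>t. (step P x ^^ t) s = s')"

lemma reaches_refl: "reaches P x s s"
  unfolding reaches_def by (rule exI[of _ 0]) simp

lemma reaches_step:
  assumes "reaches P x (step P x s) s'"
  shows "reaches P x s s'"
proof -
  obtain t where "(step P x ^^ t) (step P x s) = s'" using assms unfolding reaches_def by blast
  then have "(step P x ^^ Suc t) s = s'" by (simp only: funpow_Suc_right o_apply)
  then show ?thesis unfolding reaches_def by blast
qed

lemma reaches_trans:
  assumes "reaches P x s s'" "reaches P x s' s''"
  shows "reaches P x s s''"
proof -
  obtain t t' where "(step P x ^^ t) s = s'" "(step P x ^^ t') s' = s''"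
    using assms unfolding reaches_def by blast
  then have "(step P x ^^ (t' + t)) s = s''" by (simp only: funpow_add o_apply)
  then show ?thesis unfolding reaches_def by blast
qed

lemma compile_Block:
  assumes "\<forall>a\<in>set as. straight a"
  shows "reaches (pre @ as @ post) x (length pre, r) (length pre + length as, sem x (Block as) r)"
  using assms
proof (induction as arbitrary: pre r)
  case Nil
  then show ?case by (simp add: reaches_refl)
next
  case (Cons a as)
  have "step (pre @ (a # as) @ post) x (length pre, r) =
      (length (pre @ [a]), snd (exec x a (0, r)))"
    using Cons.prems exec_straight[of a x "length pre" r] by (simp add: step_def)
  then show ?case
    using Cons.IH[of "pre @ [a]" "snd (exec x a (0, r))"] Cons.prems
    by - (rule reaches_step, simp)
qed

text \<open>Arbitrary surrounding code \<open>pre\<close> and \<open>post\<close> carries the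
  induction, since the code of a subprogram sits inside that of the whole program.\<close>

lemma compile_correct:
  assumes "wf_prog p"
  shows "reaches (pre @ compile (length pre) p @ post) x
    (length pre, r) (length pre + code_length p, sem x p r)"
  using assms
proof (induction p arbitrary: pre post r)
  case (Block as)
  then show ?case using compile_Block by simp
next
  case (Seq p q)
  let ?P = "pre @ compile (length pre) (p ;; q) @ post"
  have "reaches ?P x (length pre, r) (length pre + code_length p, sem x p r)"
    using Seq.IH(1)[of pre "compile (length pre + code_length p) q @ post" r] Seq.prems by simp
  moreover have "reaches ?P x (length pre + code_length p, sem x p r)
      (length pre + code_length (p ;; q), sem x (p ;; q) r)"
    using Seq.IH(2)[of "pre @ compile (length pre) p" post "sem x p r"] Seq.prems
    by (simp add: add.assoc)
  ultimately show ?case by (rule reaches_trans)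
next
  case (Loop i p)
  define b where "b = length pre"
  define P where "P = pre @ compile b (Loop i p) @ post"
  let ?body = "\<lambda>r. sem x p (r(0 := 1, i := r i - 1))"
  have P_nth: "P ! (b + k) = (compile b (Loop i p) @ post) ! k" for k
    unfolding P_def b_def by (rule nth_append_length_plus)
  have nth: "P ! b = JumpZero i (b + code_length p + 4)" "P ! (b + 1) = Const 0 1"
    "P ! (b + 2) = Sub i i 0" "P ! (b + (3 + code_length p)) = Jump b"
    using P_nth[of 0] P_nth[of 1] P_nth[of 2] P_nth[of "3 + code_length p"]
    by (simp_all add: nth_append)
  have len: "length P = b + code_length p + 4 + length post"
    by (simp add: P_def b_def)
  have i: "i \<noteq> 0" using Loop.prems by simp
  have keep: "sem x p r i = r i" for r
    using Loop.prems by (intro sem_preserves) auto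
  \<comment> \<open>The structural hypothesis covers one run of the body; an inner induction on the
    counter chains the runs.\<close>
  have "reaches P x (b, r) (b + code_length (Loop i p), (?body ^^ k) r)" if "r i = k" for k r
    using that
  proof (induction k arbitrary: r)
    case 0
    then have "step P x (b, r) = (b + code_length (Loop i p), r)"
      using nth(1) len by (simp add: step_def)
    then show ?case by - (rule reaches_step, simp add: reaches_refl)
  next
    case (Suc k)
    let ?r = "r(0 := 1, i := r i - 1)"
    have s1: "step P x (b, r) = (b + 1, r)"
      using nth(1) len Suc.prems by (simp add: step_def)
    have s2: "step P x (b + 1, r) = (b + 2, r(0 := 1))"
      using nth(2) len by (simp add: step_def)
    have s3: "step P x (b + 2, r(0 := 1)) = (b + 3, ?r)"
      using nth(3) len i by (simp add: step_def)
    have s4: "step P x (b + (3 + code_length p), ?body r) = (b, ?body r)"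
      using nth(4) len by (simp add: step_def)
    have "reaches P x (b + 3, ?r) (b + (3 + code_length p), ?body r)"
      using Loop.IH[of "pre @ [JumpZero i (b + code_length p + 4), Const 0 1, Sub i i 0]"
          "[Jump b] @ post" ?r] Loop.prems
      by (simp add: P_def b_def add.assoc numeral_3_eq_3 del: fun_upd_apply)
    moreover have "?body r i = k" using Suc.prems keep i by simp
    then have "reaches P x (b, ?body r) (b + code_length (Loop i p), (?body ^^ k) (?body r))"
      by (rule Suc.IH)
    then have "reaches P x (b + (3 + code_length p), ?body r)
        (b + code_length (Loop i p), (?body ^^ k) (?body r))"
      by - (rule reaches_step, simp only: s4)
    ultimately have "reaches P x (b + 3, ?r)
        (b + code_length (Loop i p), (?body ^^ k) (?body r))"
      by (rule reaches_trans)
    then have "reaches P x (b, r) (b + code_length (Loop i p), (?body ^^ k) (?body r))"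
      using reaches_step[of P x "(b, r)"] reaches_step[of P x "(b + 1, r)"]
        reaches_step[of P x "(b + 2, r(0 := 1))"]
      by (simp only: s1 s2 s3)
    then show ?case by (simp only: funpow_Suc_right o_apply)
  qed
  then show ?case by (simp add: P_def b_def)
qed

lemma compile_outputs:
  assumes "wf_prog p"
  shows "\<exists>t. outputs_within (compile 0 p) x t (sem x p (\<lambda>_. 0) 0)"
proof -
  obtain t where "(step (compile 0 p) x ^^ t) (0, \<lambda>_. 0) = (code_length p, sem x p (\<lambda>_. 0))"
    using compile_correct[OF assms, of "[]" "[]" x "\<lambda>_. 0"] by (auto simp: reaches_def)
  then show ?thesis by (intro exI[of _ t]) (simp add: outputs_within_def)
qed

text \<open>\<open>k\<close> counts completed rounds. The body does not write the counter, so its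
  value in each round is known; it is exposed in \<open>pres\<close> because the main loop reads its
  counter as the current mask.\<close>

lemma sem_Loop_invariant:
  assumes wf: "wf_prog (Loop i p)" and init: "I 0 r"
    and pres: "\<And>k s. k < r i \<Longrightarrow> s i = r i - k \<Longrightarrow> I k s \<Longrightarrow>
      I (Suc k) (sem x p (s(0 := 1, i := r i - Suc k)))"
  shows "I (r i) (sem x (Loop i p) r)"
proof -
  let ?body = "\<lambda>r. sem x p (r(0 := 1, i := r i - 1))"
  have keep: "sem x p s i = s i" for s using wf sem_preserves by simp
  have "I k ((?body ^^ k) r) \<and> (?body ^^ k) r i = r i - k" if "k \<le> r i" for k
    using that
  proof (induction k)
    case (Suc k)
    let ?s = "(?body ^^ k) r"
    have "k \<le> r i" using Suc.prems by simp
    then have s: "I k ?s" "?s i = r i - k" using Suc.IH by blast+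
    then have "I (Suc k) (sem x p (?s(0 := 1, i := r i - Suc k)))"
      using pres Suc.prems by simp
    moreover have "?body ?s i = r i - Suc k" using keep s wf by simp
    ultimately show ?case using s by (simp del: fun_upd_apply)
  qed (use init in simp)
  then show ?thesis by simp
qed

section \<open>The brute-force program\<close>

text \<open>
  Register 19 holds the number \<open>n\<close> of vertices, register 2 the current vertex set as a bit mask.
  Registers 3 and 4 collect the size of that set and the number of vertices at which it fails to
  be a maximal independent set, registers 5 and 10 are copies of the mask that are shifted, and
  register 6 is the current position in the input.  Registers 16 and 17 hold the maxima of \<open>s\<close> and
  of \<open>n - s\<close> over the sizes \<open>s\<close> of the maximal independent sets seen so far.
\<close>

definition column_prog :: prog where
  "column_prog = Block [Half 12 10, Add 13 12 12, Sub 14 10 13, Half 10 10, Read 15 6,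
     Add 14 14 15, Const 13 1, Sub 14 14 13, Add 9 9 14, Add 6 6 13]"

text \<open>The two truncated differences added to register 4 make up the absolute difference
  between the membership bit and the indicator that no neighbour is in the set.\<close>

definition row_prog :: prog where
  "row_prog =
     Block [Half 12 5, Add 13 12 12, Sub 8 5 13, Half 5 5, Add 3 3 8, Const 9 0, Const 10 0,
       Add 10 10 2, Const 11 0, Add 11 11 19] ;;
     Loop 11 column_prog ;;
     Block [Const 13 1, Sub 13 13 9, Sub 12 8 13, Sub 13 13 8, Add 4 4 12, Add 4 4 13]"

text \<open>\<open>Loop 18\<close> is a conditional: its counter is 1 if register 4 is zero, and 0
  otherwise. Maxima are formed as \<open>a + (b - a)\<close> with truncated subtraction.\<close>

definition mask_prog :: prog where
  "mask_prog =
     Block [Const 3 0, Const 4 0, Const 5 0, Add 5 5 2, Const 6 1, Const 7 0, Add 7 7 19] ;;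
     Loop 7 row_prog ;;
     Block [Const 18 1, Sub 18 18 4] ;;
     Loop 18 (Block [Sub 12 3 16, Add 16 16 12, Sub 12 19 3, Sub 12 12 17, Add 17 17 12])"

text \<open>Register 2 is raised to \<open>2 ^ n\<close> by doubling and is then both loop counter
  and mask, so the masks run from \<open>2 ^ n - 1\<close> down to 0. The maximum of
  \<open>n - s\<close> stands in for a minimum of \<open>s\<close> because 0 is a neutral start for
  maxima.\<close>

definition well_covered_prog :: prog where
  "well_covered_prog =
     Block [Read 19 0, Const 2 1, Const 7 0, Add 7 7 19] ;;
     Loop 7 (Block [Add 2 2 2]) ;;
     Loop 2 mask_prog ;;
     Block [Add 12 16 17, Sub 12 12 19, Const 0 1, Sub 0 0 12]"

lemma wf_column: "wf_prog (Loop 11 column_prog)"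
  by (simp add: column_prog_def)

lemma wf_row: "wf_prog (Loop 7 row_prog)"
  by (simp add: row_prog_def column_prog_def)

lemma wf_mask: "wf_prog (Loop 2 mask_prog)"
  by (simp add: mask_prog_def row_prog_def column_prog_def)

lemma wf_well_covered_prog: "wf_prog well_covered_prog"
  using wf_mask by (simp add: well_covered_prog_def)

section \<open>What the loops compute on bit masks\<close>

definition input_at :: "nat list \<Rightarrow> nat \<Rightarrow> nat" where
  "input_at x k = (if k < length x then x ! k else 0)"

definition mask_bit :: "nat \<Rightarrow> nat \<Rightarrow> nat" where
  "mask_bit m j = m div 2 ^ j mod 2"

text \<open>
  For bits \<open>a\<close> and \<open>b\<close> the truncated difference \<open>a + b - 1\<close> is their product, and \<open>1 - k\<close> tests
  whether \<open>k\<close> is zero.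
\<close>

definition mask_neighbours :: "nat list \<Rightarrow> nat \<Rightarrow> nat \<Rightarrow> nat \<Rightarrow> nat" where
  "mask_neighbours x n m k = (\<Sum>j<n. mask_bit m j + input_at x (k + j) - 1)"

lemma minus_twice_half: "w - (w div 2 + w div 2) = (w mod 2 :: nat)"
  by presburger

lemma div_power_Suc: "m div 2 ^ Suc k = (m div 2 ^ k div 2 :: nat)"
  by (simp add: div_mult2_eq[symmetric] mult.commute)

lemma sem_column_loop:
  fixes x :: "nat list" and r :: "nat \<Rightarrow> nat"
  defines "s \<equiv> sem x (Loop 11 column_prog) r"
  shows "s 6 = r 6 + r 11"
    and "s 9 = r 9 + mask_neighbours x (r 11) (r 10) (r 6)"
proof -
  define I where "I k s \<longleftrightarrow> s 6 = r 6 + k \<and> s 10 = r 10 div 2 ^ k \<and>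
      s 9 = r 9 + mask_neighbours x k (r 10) (r 6)" for k and s :: "nat \<Rightarrow> nat"
  have "I (r 11) s"
    unfolding s_def
  proof (rule sem_Loop_invariant[OF wf_column])
    show "I 0 r" by (simp add: I_def mask_neighbours_def)
    show "I (Suc k) (sem x column_prog (s(0 := 1, 11 := r 11 - Suc k)))" if "I k s" for k s
      using that
      by (simp add: I_def column_prog_def minus_twice_half mask_neighbours_def mask_bit_def
          input_at_def div_power_Suc del: power_Suc)
  qed
  then show "s 6 = r 6 + r 11" "s 9 = r 9 + mask_neighbours x (r 11) (r 10) (r 6)"
    by (auto simp: I_def)
qed

lemma sem_row:
  fixes x :: "nat list" and r :: "nat \<Rightarrow> nat"
  defines "s \<equiv> sem x row_prog r"
  defines "b \<equiv> r 5 mod 2" and "c \<equiv> mask_neighbours x (r 19) (r 2) (r 6)"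
  shows "s 3 = r 3 + b" and "s 4 = r 4 + (b - (1 - c)) + ((1 - c) - b)"
    and "s 5 = r 5 div 2" and "s 6 = r 6 + r 19" and "s 19 = r 19" and "s 2 = r 2"
proof -
  define p where "p = sem x (Block [Half 12 5, Add 13 12 12, Sub 8 5 13, Half 5 5, Add 3 3 8,
      Const 9 0, Const 10 0, Add 10 10 2, Const 11 0, Add 11 11 19]) r"
  have p: "p 3 = r 3 + b" "p 4 = r 4" "p 5 = r 5 div 2" "p 6 = r 6" "p 19 = r 19" "p 2 = r 2"
    "p 8 = b" "p 9 = 0" "p 10 = r 2" "p 11 = r 19"
    by (simp_all add: p_def b_def minus_twice_half)
  define q where "q = sem x (Loop 11 column_prog) p"
  have "q j = p j" if "j \<in> {2, 3, 4, 5, 8, 19}" for j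
    unfolding q_def using that by (intro sem_preserves wf_column) (auto simp: column_prog_def)
  then have q: "q 3 = r 3 + b" "q 4 = r 4" "q 5 = r 5 div 2" "q 19 = r 19" "q 2 = r 2" "q 8 = b"
    "q 6 = r 6 + r 19" "q 9 = c"
    using sem_column_loop[of x p] by (simp_all add: p q_def c_def del: sem.simps)
  have s: "s = sem x (Block [Const 13 1, Sub 13 13 9, Sub 12 8 13, Sub 13 13 8, Add 4 4 12,
      Add 4 4 13]) q"
    by (simp only: s_def q_def p_def row_prog_def sem.simps(2))
  show "s 3 = r 3 + b" "s 4 = r 4 + (b - (1 - c)) + ((1 - c) - b)"
    "s 5 = r 5 div 2" "s 6 = r 6 + r 19" "s 19 = r 19" "s 2 = r 2"
    by (simp_all add: s q)
qed

definition mask_size :: "nat \<Rightarrow> nat \<Rightarrow> nat" where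
  "mask_size n m = (\<Sum>j<n. mask_bit m j)"

text \<open>Row \<open>v\<close> of the matrix starts at \<open>1 + v * n\<close>, after the entry
  that holds \<open>n\<close>.\<close>

definition mask_maximal :: "nat list \<Rightarrow> nat \<Rightarrow> nat \<Rightarrow> bool" where
  "mask_maximal x n m \<longleftrightarrow>
     (\<forall>v<n. mask_bit m v = 1 - mask_neighbours x n m (1 + v * n))"

lemma sem_row_loop:
  fixes x :: "nat list" and r :: "nat \<Rightarrow> nat"
  defines "s \<equiv> sem x (Loop 7 row_prog) r"
  assumes r: "r 3 = 0" "r 4 = 0" "r 5 = r 2" "r 6 = 1" "r 7 = r 19"
  shows "s 3 = mask_size (r 19) (r 2)" and "s 4 = 0 \<longleftrightarrow> mask_maximal x (r 19) (r 2)"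
proof -
  define I where "I k s \<longleftrightarrow> s 19 = r 19 \<and> s 2 = r 2 \<and> s 3 = mask_size k (r 2) \<and>
      s 5 = r 2 div 2 ^ k \<and> s 6 = 1 + k * r 19 \<and>
      (s 4 = 0 \<longleftrightarrow> (\<forall>v<k. mask_bit (r 2) v = 1 - mask_neighbours x (r 19) (r 2) (1 + v * r 19)))"
    for k and s :: "nat \<Rightarrow> nat"
  have "I (r 7) s"
    unfolding s_def
  proof (rule sem_Loop_invariant[OF wf_row])
    show "I 0 r" using r by (simp add: I_def mask_size_def)
    fix k s
    assume I: "I k s"
    show "I (Suc k) (sem x row_prog (s(0 := 1, 7 := r 7 - Suc k)))"
    proof -
      have "a - (1 - c) = 0 \<and> 1 - c - a = 0 \<longleftrightarrow> a = 1 - c" for a c :: nat by linarith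
      then show ?thesis
        using I by (auto simp: I_def sem_row mask_size_def mask_bit_def
            div_mult2_eq[symmetric] mult.commute less_Suc_eq)
    qed
  qed
  then show "s 3 = mask_size (r 19) (r 2)" "s 4 = 0 \<longleftrightarrow> mask_maximal x (r 19) (r 2)"
    using r by (auto simp: I_def mask_maximal_def)
qed

lemma sem_mask:
  fixes x :: "nat list" and r :: "nat \<Rightarrow> nat"
  defines "s \<equiv> sem x mask_prog r"
  defines "z \<equiv> mask_size (r 19) (r 2)" and "ok \<equiv> mask_maximal x (r 19) (r 2)"
  shows "s 16 = (if ok then max (r 16) z else r 16)"
    and "s 17 = (if ok then max (r 17) (r 19 - z) else r 17)" and "s 19 = r 19"
proof -
  define p where "p = sem x (Block [Const 3 0, Const 4 0, Const 5 0, Add 5 5 2, Const 6 1,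
      Const 7 0, Add 7 7 19]) r"
  have p: "p 3 = 0" "p 4 = 0" "p 5 = p 2" "p 6 = 1" "p 7 = p 19"
    "p 2 = r 2" "p 19 = r 19" "p 16 = r 16" "p 17 = r 17"
    by (simp_all add: p_def)
  define q where "q = sem x (Loop 7 row_prog) p"
  have "q j = p j" if "j \<in> {16, 17, 19}" for j
    unfolding q_def using that
    by (intro sem_preserves wf_row) (auto simp: row_prog_def column_prog_def)
  then have q: "q 19 = r 19" "q 16 = r 16" "q 17 = r 17" "q 3 = z" "q 4 = 0 \<longleftrightarrow> ok"
    using sem_row_loop[OF p(1-5), of x] by (simp_all add: p q_def z_def ok_def del: sem.simps)
  have s: "s = sem x (Loop 18 (Block [Sub 12 3 16, Add 16 16 12, Sub 12 19 3, Sub 12 12 17,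
      Add 17 17 12])) (sem x (Block [Const 18 1, Sub 18 18 4]) q)"
    by (simp only: s_def q_def p_def mask_prog_def sem.simps(2))
  show "s 16 = (if ok then max (r 16) z else r 16)"
    "s 17 = (if ok then max (r 17) (r 19 - z) else r 17)" "s 19 = r 19"
    unfolding s using q by (cases "q 4"; auto simp: max_def)+
qed

lemma sem_well_covered_prog:
  assumes n: "input_at x 0 = n"
  shows "sem x well_covered_prog (\<lambda>_. 0) 0 =
    (if \<forall>m<2 ^ n. \<forall>m'<2 ^ n. mask_maximal x n m \<and> mask_maximal x n m' \<longrightarrow>
       mask_size n m = mask_size n m' then 1 else 0)"
proof -
  have size_le: "mask_size n m \<le> n" for m
    using sum_bounded_above[of "{..<n}" "mask_bit m" 1]
    by (simp add: mask_size_def mask_bit_def)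
  define r0 where "r0 = sem x (Block [Read 19 0, Const 2 1, Const 7 0, Add 7 7 19]) (\<lambda>_. 0)"
  have r0: "r0 19 = n" "r0 2 = 1" "r0 7 = n" "r0 16 = 0" "r0 17 = 0"
    using n by (auto simp: r0_def input_at_def)
  define r1 where "r1 = sem x (Loop 7 (Block [Add 2 2 2])) r0"
  have wf: "wf_prog (Loop 7 (Block [Add 2 2 2]))" by simp
  have "r1 2 = 2 ^ r0 7"
    unfolding r1_def
    by (rule sem_Loop_invariant[OF wf, where I = "\<lambda>k s. s 2 = 2 ^ k"]) (use r0 in auto)
  moreover have "r1 j = r0 j" if "j \<in> {16, 17, 19}" for j
    using that sem_preserves[OF wf, of j] by (auto simp: r1_def)
  ultimately have r1: "r1 2 = 2 ^ n" "r1 19 = n" "r1 16 = 0" "r1 17 = 0" using r0 by auto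
  define r2 where "r2 = sem x (Loop 2 mask_prog) r1"
  \<comment> \<open>Masks are visited in decreasing order, so those from \<open>2 ^ n - k\<close> on
    have been seen. The alternatives \<open>= 0\<close> cover the initial values.\<close>
  define I where "I k s \<longleftrightarrow> s 19 = n \<and>
      (\<forall>m. 2 ^ n - k \<le> m \<and> m < 2 ^ n \<and> mask_maximal x n m \<longrightarrow>
         mask_size n m \<le> s 16 \<and> n - mask_size n m \<le> s 17) \<and>
      (s 16 = 0 \<or> (\<exists>m<2 ^ n. mask_maximal x n m \<and> s 16 = mask_size n m)) \<and>
      (s 17 = 0 \<or> (\<exists>m<2 ^ n. mask_maximal x n m \<and> s 17 = n - mask_size n m))"
    for k and s :: "nat \<Rightarrow> nat"
  have "I (r1 2) r2"
    unfolding r2_def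
  proof (rule sem_Loop_invariant[OF wf_mask])
    show "I 0 r1" using r1 by (auto simp: I_def)
    fix k s
    assume k: "k < r1 2" and I: "I k s"
    let ?m = "r1 2 - Suc k"
    let ?s = "sem x mask_prog (s(0 := 1, 2 := ?m))"
    have m: "?m < 2 ^ n" using k r1 by simp
    have "m = ?m \<or> 2 ^ n - k \<le> m" if "2 ^ n - Suc k \<le> m" for m
      using that r1 k by linarith
    moreover have "?s 19 = n"
      "?s 16 = (if mask_maximal x n ?m then max (s 16) (mask_size n ?m) else s 16)"
      "?s 17 = (if mask_maximal x n ?m then max (s 17) (n - mask_size n ?m) else s 17)"
      using I by (simp_all add: sem_mask I_def)
    ultimately show "I (Suc k) ?s"
      using I m unfolding I_def by (smt (verit) le_max_iff_disj max_def order_refl)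
  qed
  then have I: "I (2 ^ n) r2" by (simp add: r1)
  have out: "sem x well_covered_prog (\<lambda>_. 0) 0 = 1 - (r2 16 + r2 17 - r2 19)"
  proof -
    have "sem x well_covered_prog (\<lambda>_. 0) =
        sem x (Block [Add 12 16 17, Sub 12 12 19, Const 0 1, Sub 0 0 12]) r2"
      by (simp only: well_covered_prog_def r2_def r1_def r0_def sem.simps(2))
    then show ?thesis by simp
  qed
  have r2: "r2 19 = n" using I by (simp add: I_def)
  \<comment> \<open>If the sum is at most \<open>n\<close>, any two sizes satisfy
    \<open>s + (n - s') \<le> n\<close>, so \<open>s \<le> s'\<close>, and equality follows by
    symmetry. Conversely, equal sizes give the sum \<open>n\<close>, and a register still at 0
    leaves a sum of at most \<open>n\<close>.\<close>
  have iff: "r2 16 + r2 17 \<le> n \<longleftrightarrow>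
      (\<forall>m<2 ^ n. \<forall>m'<2 ^ n. mask_maximal x n m \<and> mask_maximal x n m' \<longrightarrow>
         mask_size n m = mask_size n m')" (is "?L \<longleftrightarrow> ?R")
  proof
    assume ?L
    have "mask_size n m \<le> mask_size n m'"
      if "m < 2 ^ n" "m' < 2 ^ n" "mask_maximal x n m" "mask_maximal x n m'" for m m'
    proof -
      have "mask_size n m \<le> r2 16" "n - mask_size n m' \<le> r2 17"
        using I that by (auto simp: I_def)
      then show ?thesis using \<open>?L\<close> size_le[of m'] by linarith
    qed
    then show ?R by (meson order_antisym)
  next
    assume R: ?R
    have "r2 16 = 0 \<or> (\<exists>m<2 ^ n. mask_maximal x n m \<and> r2 16 = mask_size n m)"
      "r2 17 = 0 \<or> (\<exists>m<2 ^ n. mask_maximal x n m \<and> r2 17 = n - mask_size n m)"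
      using I unfolding I_def by blast+
    then show ?L
    proof (elim disjE exE conjE)
      fix m m'
      assume *: "m < 2 ^ n" "mask_maximal x n m" "r2 16 = mask_size n m"
        "m' < 2 ^ n" "mask_maximal x n m'" "r2 17 = n - mask_size n m'"
      then have "mask_size n m = mask_size n m'" using R by blast
      then show ?L using * size_le[of m'] by simp
    qed (use size_le in auto)
  qed
  show ?thesis unfolding out r2 iff[symmetric] by auto
qed

section \<open>Correctness on encodings of graphs\<close>

lemma nth_concat_rows:
  assumes "i < length us" "j < length vs"
  shows "concat (map (\<lambda>u. map (f u) vs) us) ! (i * length vs + j) = f (us ! i) (vs ! j)"
  using assms
proof (induction us arbitrary: i)
  case (Cons u us)
  then show ?case by (cases i) (auto simp: nth_append add.assoc)
qed simp

lemma length_concat_rows: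
  "length (concat (map (\<lambda>u. map (f u) vs) us)) = length us * length vs"
  by (induction us) auto

lemma encode_eq_concat:
  "encode G vs =
     length vs # concat (map (\<lambda>u. map (\<lambda>v. if {u, v} \<in> edges G then 1 else 0) vs) vs)"
  by (simp add: encode_def)

lemma input_at_encode:
  assumes "i < length vs" "j < length vs"
  shows "input_at (encode G vs) (1 + i * length vs + j) =
    (if {vs ! i, vs ! j} \<in> edges G then 1 else 0)"
proof -
  have "i * length vs + j < Suc i * length vs" using assms by simp
  also have "\<dots> \<le> length vs * length vs" using assms(1) by (intro mult_le_mono) auto
  finally show ?thesis
    using nth_concat_rows[OF assms, of "\<lambda>u v. if {u, v} \<in> edges G then 1 else (0 :: nat)"]
    by (simp add: input_at_def encode_eq_concat length_concat_rows)
qed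

text \<open>Replaces the quantifier over supersets by a test at each vertex: a vertex without
  neighbours in \<open>S\<close> can be inserted, as there are no loops.\<close>

lemma maximal_independent_iff:
  assumes G: "simple_graph G"
  shows "maximal_independent G S \<longleftrightarrow>
    S \<subseteq> verts G \<and> (\<forall>v\<in>verts G. v \<in> S \<longleftrightarrow> (\<forall>u\<in>S. {v, u} \<notin> edges G))" (is "?L \<longleftrightarrow> ?R")
proof
  assume L: ?L
  then have ind: "independent G S" by (simp add: maximal_independent_def)
  have loop: "{v} \<notin> edges G" for v using G by (auto simp: simple_graph_def)
  have "v \<in> S" if v: "v \<in> verts G" "\<forall>u\<in>S. {v, u} \<notin> edges G" for v
  proof -
    have "independent G (insert v S)"
      using ind v loop by (auto simp: independent_def insert_commute)
    then show ?thesis using L unfolding maximal_independent_def by blast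
  qed
  then show ?R using ind by (auto simp: independent_def)
next
  assume R: ?R
  then have "independent G S" by (auto simp: independent_def)
  moreover have "T = S" if T: "independent G T" "S \<subseteq> T" for T
  proof -
    have "v \<in> S" if "v \<in> T" for v
      using T that R by (auto simp: independent_def subset_iff)
    then show ?thesis using T by blast
  qed
  ultimately show ?L by (auto simp: maximal_independent_def)
qed

definition mask_set :: "'a list \<Rightarrow> nat \<Rightarrow> 'a set" where
  "mask_set vs m = (!) vs ` {j. j < length vs \<and> mask_bit m j = 1}"

lemma mask_bit_cases: "mask_bit m j = 0 \<or> mask_bit m j = 1"
  by (auto simp: mask_bit_def)

lemma card_mask_set:
  assumes "distinct vs"
  shows "card (mask_set vs m) = mask_size (length vs) m"
proof -
  have "mask_bit m j = (if mask_bit m j = 1 then 1 else 0)" for j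
    using mask_bit_cases[of m j] by auto
  then have "mask_size (length vs) m = (\<Sum>j<length vs. if mask_bit m j = 1 then 1 else 0)"
    unfolding mask_size_def by (rule sum.cong[OF refl])
  also have "\<dots> = card {j. j < length vs \<and> mask_bit m j = 1}"
    by (simp add: sum.If_cases lessThan_def Collect_conj_eq)
  also have "\<dots> = card (mask_set vs m)"
    unfolding mask_set_def
    using assms by (intro card_image[symmetric] inj_onI) (auto simp: nth_eq_iff_index_eq)
  finally show ?thesis by simp
qed

text \<open>The mask is the binary code of the positions whose entries lie in \<open>S\<close>; it
  is at most the sum of all \<open>2 ^ j\<close> with \<open>j < length vs\<close>.\<close>

lemma mask_set_surj:
  assumes "S \<subseteq> set vs" "distinct vs"
  shows "\<exists>m<2 ^ length vs. mask_set vs m = S"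
proof -
  let ?J = "{j. j < length vs \<and> vs ! j \<in> S}"
  let ?m = "set_encode ?J"
  have "?m \<le> set_encode {..<length vs}"
    unfolding set_encode_def by (intro sum_mono2) auto
  also have "\<dots> < 2 ^ length vs"
    by (simp add: set_encode_def atLeast0LessThan[symmetric] sum_power2)
  finally have "?m < 2 ^ length vs" .
  moreover have "mask_bit ?m j = 1 \<longleftrightarrow> j \<in> ?J" for j
    using set_encode_inverse[of ?J] unfolding set_decode_def mask_bit_def
    by (auto simp: odd_iff_mod_2_eq_one)
  then have "mask_set vs ?m = (!) vs ` ?J" by (auto simp: mask_set_def)
  then have "mask_set vs ?m = S" using assms(1) by (fastforce simp: in_set_conv_nth)
  ultimately show ?thesis by blast
qed

text \<open>A sum of naturals vanishes iff every summand does, and summand \<open>j\<close> is 1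
  exactly when \<open>vs ! j\<close> is in the set and adjacent to \<open>vs ! v\<close>.\<close>

lemma mask_maximal_encode:
  assumes G: "simple_graph G" and vs: "distinct vs" "set vs = verts G"
  shows "mask_maximal (encode G vs) (length vs) m \<longleftrightarrow> maximal_independent G (mask_set vs m)"
proof -
  let ?n = "length vs"
  have zero: "mask_neighbours (encode G vs) ?n m (1 + v * ?n) = 0 \<longleftrightarrow>
      (\<forall>u\<in>mask_set vs m. {vs ! v, u} \<notin> edges G)" if v: "v < ?n" for v
  proof -
    have "mask_bit m j + input_at (encode G vs) (1 + v * ?n + j) - 1 = 0 \<longleftrightarrow>
        \<not> (mask_bit m j = 1 \<and> {vs ! v, vs ! j} \<in> edges G)" if "j < ?n" for j
      using mask_bit_cases[of m j] unfolding input_at_encode[OF v that] by auto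
    then show ?thesis by (auto simp: mask_neighbours_def mask_set_def)
  qed
  have mem: "vs ! v \<in> mask_set vs m \<longleftrightarrow> mask_bit m v = 1" if "v < ?n" for v
    using that vs by (auto simp: mask_set_def nth_eq_iff_index_eq)
  have key: "mask_bit m v = 1 - mask_neighbours (encode G vs) ?n m (1 + v * ?n) \<longleftrightarrow>
      (vs ! v \<in> mask_set vs m \<longleftrightarrow> (\<forall>u\<in>mask_set vs m. {vs ! v, u} \<notin> edges G))"
    if v: "v < ?n" for v
    unfolding zero[OF v, symmetric] mem[OF v] using mask_bit_cases[of m v] by linarith
  have sub: "mask_set vs m \<subseteq> set vs" by (auto simp: mask_set_def)
  have "mask_maximal (encode G vs) ?n m \<longleftrightarrow> (\<forall>v<?n. vs ! v \<in> mask_set vs m \<longleftrightarrow>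
      (\<forall>u\<in>mask_set vs m. {vs ! v, u} \<notin> edges G))"
    unfolding mask_maximal_def using key by (simp only: cong: imp_cong)
  also have "\<dots> \<longleftrightarrow> maximal_independent G (mask_set vs m)"
    unfolding maximal_independent_iff[OF G] vs(2)[symmetric] all_set_conv_all_nth
    using sub by (simp only: simp_thms)
  finally show ?thesis .
qed

lemma well_covered_prog_correct:
  assumes G: "simple_graph G" and vs: "distinct vs" "set vs = verts G"
  shows "sem (encode G vs) well_covered_prog (\<lambda>_. 0) 0 = (if well_covered G then 1 else 0)"
proof -
  let ?n = "length vs"
  have "well_covered G \<longleftrightarrow> (\<forall>m<2 ^ ?n. \<forall>m'<2 ^ ?n.
      maximal_independent G (mask_set vs m) \<and> maximal_independent G (mask_set vs m') \<longrightarrow>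
      card (mask_set vs m) = card (mask_set vs m'))" (is "_ \<longleftrightarrow> ?R")
  proof
    assume R: ?R
    have "\<exists>m<2 ^ ?n. mask_set vs m = S" if "maximal_independent G S" for S
      using that vs by (intro mask_set_surj) (auto simp: maximal_independent_iff[OF G])
    then show "well_covered G" using R unfolding well_covered_def by metis
  qed (auto simp: well_covered_def)
  moreover have "input_at (encode G vs) 0 = ?n" by (simp add: input_at_def encode_def)
  ultimately show ?thesis
    by (simp add: sem_well_covered_prog mask_maximal_encode[OF assms] card_mask_set[OF vs(1)])
qed

section \<open>The running time and the theorem\<close>

text \<open>The graphs themselves may be infinitely many, but their encodings have fixed length and
  bounded entries; \<open>Suc n\<close> bounds the bits even for \<open>n = 0\<close>.\<close>

lemma finite_encodings: "finite {encode G vs | G vs. length vs = n}"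
proof (rule finite_subset)
  have "length (encode G vs) = Suc (n * n) \<and> set (encode G vs) \<subseteq> {..Suc n}"
    if "length vs = n" for G vs
    using that by (auto simp: encode_eq_concat length_concat_rows)
  then show "{encode G vs | G vs. length vs = n} \<subseteq>
      {x. set x \<subseteq> {..Suc n} \<and> length x = Suc (n * n)}"
    by auto
qed (rule finite_lists_length_eq, simp)

text \<open>\<open>g n\<close> is the largest halting time over the finitely many encodings with
  \<open>n\<close> vertices.\<close>

lemma well_covered_time_bounded_by_order:
  "\<exists>P (g :: nat \<Rightarrow> nat). \<forall>(G :: 'a ugraph) vs.
     simple_graph G \<longrightarrow> distinct vs \<longrightarrow> set vs = verts G \<longrightarrow>
     (\<exists>t \<le> g (card (verts G)). outputs_within P (encode G vs) t (if well_covered G then 1 else 0))"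
proof -
  let ?P = "compile 0 well_covered_prog"
  obtain T where T: "outputs_within ?P x (T x) (sem x well_covered_prog (\<lambda>_. 0) 0)" for x
    using compile_outputs[OF wf_well_covered_prog] by metis
  define X where "X n = {encode G vs | (G :: 'a ugraph) vs. length vs = n}" for n
  define g where "g n = Max (T ` X n)" for n
  have "\<exists>t \<le> g (card (verts G)). outputs_within ?P (encode G vs) t (if well_covered G then 1 else 0)"
    if G: "simple_graph G" and vs: "distinct vs" "set vs = verts G" for G :: "'a ugraph" and vs
  proof (intro exI conjI)
    have "length vs = card (verts G)" using vs distinct_card by fastforce
    then have "encode G vs \<in> X (card (verts G))" unfolding X_def by blast
    moreover have "finite (X n)" for n unfolding X_def by (rule finite_encodings)
    ultimately show "T (encode G vs) \<le> g (card (verts G))" by (simp add: g_def)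
    show "outputs_within ?P (encode G vs) (T (encode G vs)) (if well_covered G then 1 else 0)"
      using T[of "encode G vs"] unfolding well_covered_prog_correct[OF that] .
  qed
  then show ?thesis by blast
qed

theorem theorem11:
  fixes \<C> :: "'a ugraph set"
  assumes "\<forall>G\<in>\<C>. simple_graph G"
    and "bounded_local_treewidth \<C>"
  shows "FPT_parameterized_by \<C> well_covered alpha \<and>
    (\<exists>f :: nat \<Rightarrow> nat.
       decidable_in_time \<C> well_covered (\<lambda>G. f (alpha G) * card (verts G) ^ 2))"
proof -
  obtain h where h: "\<And>G. G \<in> \<C> \<Longrightarrow> card (verts G) \<le> h (alpha G)"
    using bounded_local_treewidth_imp_order_bounded[OF assms] by blast
  obtain P and g :: "nat \<Rightarrow> nat" where P: "\<And>(G :: 'a ugraph) vs.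
      simple_graph G \<Longrightarrow> distinct vs \<Longrightarrow> set vs = verts G \<Longrightarrow>
      \<exists>t \<le> g (card (verts G)). outputs_within P (encode G vs) t (if well_covered G then 1 else 0)"
    using well_covered_time_bounded_by_order by blast
  \<comment> \<open>\<open>g\<close> is not known to be monotone, so the sum over all orders up to
    \<open>h k\<close> serves as a bound.\<close>
  define f where "f k = (\<Sum>n\<le>h k. g n)" for k
  have "decidable_in_time \<C> well_covered (\<lambda>G. f (alpha G) * card (verts G) ^ 2)"
    unfolding decidable_in_time_def
  proof (rule exI[of _ P], rule exI[of _ 1], intro ballI allI impI)
    fix G vs
    assume G: "G \<in> \<C>" and vs: "distinct vs \<and> set vs = verts G"
    have simple: "simple_graph G" using assms(1) G by blast
    obtain t where t: "t \<le> g (card (verts G))"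
      "outputs_within P (encode G vs) t (if well_covered G then 1 else 0)"
      using P[OF simple] vs by blast
    have "t \<le> 1 * (f (alpha G) * card (verts G) ^ 2)" if "verts G \<noteq> {}"
    proof -
      have "g (card (verts G)) \<le> f (alpha G)"
        unfolding f_def using h[OF G] by (intro member_le_sum) auto
      \<comment> \<open>The factor is at least 1 since the graph has a vertex.\<close>
      also have "\<dots> \<le> f (alpha G) * card (verts G) ^ 2"
        using that simple by (simp add: simple_graph_def card_gt_0_iff Suc_le_eq)
      finally show ?thesis using t(1) by simp
    qed
    then show "\<exists>t. outputs_within P (encode G vs) t (if well_covered G then 1 else 0) \<and>
        (verts G \<noteq> {} \<longrightarrow> t \<le> 1 * (f (alpha G) * card (verts G) ^ 2))"
      using t(2) by blast
  qed
  then show ?thesis unfolding FPT_parameterized_by_def by blast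
qed

end
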